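(* There exists an additive function $f:\mathbb{R}\rightarrow\mathbb{R}$ which is not identically zero and which satisfies $f(x)f\left(\frac{1}{x}\right)=0$ for every real $x\neq 0$.
   Context: A function $f:K\to K$ on a field $K$ is additive if $f(x+y)=f(x)+f(y)$ for all $x,y\in K$. *)

theory Defs
  imports "HOL-Analysis.Analysis"
begin

end

theory Submission
  imports Defs
begin

text \<open>
  An additive map of the reals is the same thing as a \<open>\<rat>\<close>-linear one, and the condition
  \<open>f x * f (1 / x) = 0\<close> says that the kernel of \<open>f\<close> contains \<open>x\<close> or \<open>1 / x\<close> for every nonzero
  \<open>x\<close>. A valuation ring \<open>A\<close> of the field \<open>\<real>\<close> contains one of \<open>x\<close> and \<open>1 / x\<close> by definition, so if
  \<open>A\<close> contains \<open>\<rat>\<close> and is not all of \<open>\<real>\<close>, then any nonzero \<open>\<rat>\<close>-linear functional that vanishes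
  on the proper \<open>\<rat>\<close>-subspace \<open>A\<close> has the required properties
  (\<open>linear_functional_vanishing_on_subspace\<close>).

  Such a ring is the ring of a nontrivial place of \<open>\<real>\<close> with residue characteristic zero. To find
  one, take a transcendental \<open>t\<close> (\<open>exists_transcendental_real\<close>). Then \<open>1 / t\<close> is not in \<open>\<rat>[t]\<close>, and by Zorn's
  lemma \<open>\<rat>[t]\<close> extends to a subring \<open>A\<close> that is maximal among those without \<open>1 / t\<close>. Such a
  maximal ring is a valuation ring (\<open>maximal_avoiding_is_valuation_ring\<close>): if neither \<open>x\<close> nor
  \<open>1 / x\<close> were in \<open>A\<close>, maximality would put \<open>1 / t\<close> into both \<open>A[x]\<close> and \<open>A[1 / x]\<close>, and of two
  representing polynomials of least degree, one in \<open>x\<close> and one in \<open>1 / x\<close>, the one whose degree is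
  not the smaller could be replaced by a polynomial of lower degree with the help of the other
  (\<open>maximal_avoiding_lower_degree\<close>).
\<close>

section \<open>Subrings of a field and adjunction of an element\<close>

definition is_subring :: "'a::field set \<Rightarrow> bool" where
  "is_subring A \<longleftrightarrow> 1 \<in> A \<and> (\<forall>x\<in>A. \<forall>y\<in>A. x - y \<in> A \<and> x * y \<in> A)"

definition polys_over :: "'a::field set \<Rightarrow> 'a poly set" where
  "polys_over A = {p. \<forall>i. coeff p i \<in> A}"

definition adjoin :: "'a::field set \<Rightarrow> 'a \<Rightarrow> 'a set" where
  "adjoin A x = (\<lambda>p. poly p x) ` polys_over A"

lemma is_subring_Rats: "is_subring (\<rat> :: 'a::field_char_0 set)"
  by (auto simp: is_subring_def)

context
  fixes A :: "'a::field set"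
  assumes A: "is_subring A"
begin

lemma subring_one: "1 \<in> A"
  and subring_diff: "x \<in> A \<Longrightarrow> y \<in> A \<Longrightarrow> x - y \<in> A"
  and subring_mult: "x \<in> A \<Longrightarrow> y \<in> A \<Longrightarrow> x * y \<in> A"
  using A by (auto simp: is_subring_def)

lemma subring_zero: "0 \<in> A"
  using subring_diff[OF subring_one subring_one] by simp

lemma subring_add: "x \<in> A \<Longrightarrow> y \<in> A \<Longrightarrow> x + y \<in> A"
  using subring_diff[of x "0 - y"] subring_diff[of 0 y] subring_zero by simp

lemma subring_power: "x \<in> A \<Longrightarrow> x ^ n \<in> A"
  by (induction n) (auto intro: subring_one subring_mult)

lemma subring_sum: "(\<And>i. i \<in> I \<Longrightarrow> g i \<in> A) \<Longrightarrow> sum g I \<in> A"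
  by (induction I rule: infinite_finite_induct) (auto intro: subring_zero subring_add)

lemma poly_in_subring: "p \<in> polys_over A \<Longrightarrow> x \<in> A \<Longrightarrow> poly p x \<in> A"
  unfolding poly_altdef polys_over_def by (auto intro!: subring_sum subring_mult subring_power)

lemma polys_over_diff: "p \<in> polys_over A \<Longrightarrow> q \<in> polys_over A \<Longrightarrow> p - q \<in> polys_over A"
  and polys_over_add: "p \<in> polys_over A \<Longrightarrow> q \<in> polys_over A \<Longrightarrow> p + q \<in> polys_over A"
  and polys_over_mult: "p \<in> polys_over A \<Longrightarrow> q \<in> polys_over A \<Longrightarrow> p * q \<in> polys_over A"
  and polys_over_smult: "c \<in> A \<Longrightarrow> p \<in> polys_over A \<Longrightarrow> smult c p \<in> polys_over A"
  and polys_over_monom: "c \<in> A \<Longrightarrow> monom c n \<in> polys_over A"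
  and polys_over_reflect: "p \<in> polys_over A \<Longrightarrow> reflect_poly p \<in> polys_over A"
  by (auto simp: polys_over_def coeff_mult coeff_reflect_poly subring_zero
      intro!: subring_diff subring_add subring_mult subring_sum)

lemma polys_over_const: "c \<in> A \<Longrightarrow> [:c:] \<in> polys_over A"
  using polys_over_monom[of c 0] by (simp add: monom_0)

lemma is_subring_adjoin: "is_subring (adjoin A x)"
proof -
  have "1 \<in> adjoin A x"
    unfolding adjoin_def by (rule image_eqI[of _ _ "[:1:]"]) (auto intro: polys_over_const subring_one)
  moreover have "a - b \<in> adjoin A x" "a * b \<in> adjoin A x"
    if "a \<in> adjoin A x" "b \<in> adjoin A x" for a b
  proof -
    from that obtain p q where "p \<in> polys_over A" "q \<in> polys_over A" "a = poly p x" "b = poly q x"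
      by (auto simp: adjoin_def)
    moreover from this have "p - q \<in> polys_over A" "p * q \<in> polys_over A"
      by (simp_all add: polys_over_diff polys_over_mult A)
    ultimately show "a - b \<in> adjoin A x" "a * b \<in> adjoin A x"
      unfolding adjoin_def by (auto simp flip: poly_diff poly_mult)
  qed
  ultimately show ?thesis by (simp add: is_subring_def)
qed

lemma subset_adjoin: "A \<subseteq> adjoin A x"
proof
  fix a assume "a \<in> A"
  then show "a \<in> adjoin A x"
    unfolding adjoin_def by (intro image_eqI[of _ _ "[:a:]"]) (auto intro: polys_over_const)
qed

lemma in_adjoin: "x \<in> adjoin A x"
  unfolding adjoin_def
  by (rule image_eqI[of _ _ "monom 1 1"]) (auto simp: poly_monom intro: polys_over_monom subring_one)

end

section \<open>Subrings that are maximal without a given inverse\<close>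

definition maximal_avoiding :: "'a::field \<Rightarrow> 'a set \<Rightarrow> bool" where
  "maximal_avoiding s A \<longleftrightarrow>
     is_subring A \<and> s \<notin> A \<and> (\<forall>B. is_subring B \<and> A \<subseteq> B \<and> s \<notin> B \<longrightarrow> B = A)"

lemma exists_maximal_avoiding:
  assumes R: "is_subring R" and s: "s \<notin> R"
  shows "\<exists>A. R \<subseteq> A \<and> maximal_avoiding s A"
proof -
  let ?F = "{B. is_subring B \<and> R \<subseteq> B \<and> s \<notin> B}"
  have "\<exists>M\<in>?F. \<forall>X\<in>?F. M \<subseteq> X \<longrightarrow> X = M"
  proof (rule subset_Zorn_nonempty)
    show "?F \<noteq> {}" using R s by auto
  next
    fix C assume ne: "C \<noteq> {}" and ch: "subset.chain ?F C"
    have sub: "is_subring B" "R \<subseteq> B" "s \<notin> B" if "B \<in> C" for B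
      using ch that by (auto simp: subset.chain_def)
    have "x - y \<in> \<Union>C \<and> x * y \<in> \<Union>C" if xy: "x \<in> \<Union>C" "y \<in> \<Union>C" for x y
    proof -
      from xy obtain X Y where XY: "X \<in> C" "Y \<in> C" "x \<in> X" "y \<in> Y" by blast
      have "X \<subseteq> Y \<or> Y \<subseteq> X" using ch XY(1,2) by (auto simp: subset.chain_def)
      then obtain Z where "Z \<in> C" "x \<in> Z" "y \<in> Z" using XY by blast
      then have "x - y \<in> Z" "x * y \<in> Z"
        using subring_diff[OF sub(1)] subring_mult[OF sub(1)] by simp_all
      then show ?thesis using \<open>Z \<in> C\<close> by blast
    qed
    moreover have "1 \<in> \<Union>C" using ne subring_one[OF sub(1)] by auto
    ultimately have "is_subring (\<Union>C)" by (simp add: is_subring_def)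
    moreover have "R \<subseteq> \<Union>C" "s \<notin> \<Union>C" using ne sub(2,3) by auto
    ultimately show "\<Union>C \<in> ?F" by blast
  qed
  then obtain M where M: "M \<in> ?F" and max: "\<forall>X\<in>?F. M \<subseteq> X \<longrightarrow> X = M" by (rule bexE)
  have "B = M" if "is_subring B" "M \<subseteq> B" "s \<notin> B" for B
    using max[rule_format, of B] that M by auto
  then have "maximal_avoiding s M" using M by (auto simp: maximal_avoiding_def)
  then show ?thesis using M by auto
qed

lemma maximal_avoiding_adjoin:
  assumes "maximal_avoiding s A" "x \<notin> A"
  shows "s \<in> adjoin A x"
  using assms is_subring_adjoin subset_adjoin in_adjoin
  unfolding maximal_avoiding_def by blast

text \<open>
  Maximality forces \<open>t\<close> into the Jacobson radical of \<open>A\<close>. With \<open>u = 1 - t * b\<close>, suppose that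
  \<open>A[1 / u]\<close> contains \<open>1 / t\<close>. Clearing denominators, \<open>u ^ k / t\<close> is in \<open>A\<close> for some \<open>k\<close>; as
  \<open>u ^ k\<close> is congruent to \<open>1\<close> modulo \<open>t\<close>, this gives \<open>1 / t \<in> A\<close>.
\<close>

lemma maximal_avoiding_inverse_one_minus:
  assumes max: "maximal_avoiding (inverse t) A" and t: "t \<in> A" "t \<noteq> 0" and b: "b \<in> A"
  shows "1 - t * b \<noteq> 0" and "inverse (1 - t * b) \<in> A"
proof -
  define u where "u = 1 - t * b"
  have A: "is_subring A" and s: "inverse t \<notin> A" using max by (auto simp: maximal_avoiding_def)
  have u: "u \<in> A"
    unfolding u_def using A t(1) b by (intro subring_diff subring_mult subring_one)
  have u0: "u \<noteq> 0"
  proof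
    assume "u = 0"
    then have "b = inverse t" using t(2) by (simp add: u_def field_simps)
    then show False using s b by simp
  qed
  have "inverse u \<in> A"
  proof (rule ccontr)
    assume "inverse u \<notin> A"
    then obtain p where p: "p \<in> polys_over A" "inverse t = poly p (inverse u)"
      using maximal_avoiding_adjoin[OF max] by (auto simp: adjoin_def)
    have "u ^ degree p * inverse t = poly (reflect_poly p) u"
      using u0 p(2) by (simp add: poly_reflect_poly_nz)
    then have 1: "u ^ degree p * inverse t \<in> A"
      using poly_in_subring[OF A polys_over_reflect[OF A p(1)] u] by simp
    have "\<exists>c\<in>A. u ^ k = 1 - t * c" for k
    proof (induction k)
      case 0
      then show ?case using subring_zero[OF A] by auto
    next
      case (Suc k)
      then obtain c where c: "c \<in> A" "u ^ k = 1 - t * c" by blast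
      have "u ^ Suc k = u - t * (u * c)" by (simp add: c(2) algebra_simps)
      then have "u ^ Suc k = 1 - t * (b + u * c)"
        by (simp only: distrib_left diff_diff_eq[symmetric] u_def)
      moreover have "b + u * c \<in> A" using A b u c(1) by (intro subring_add subring_mult)
      ultimately show ?case by blast
    qed
    then obtain c where c: "c \<in> A" "u ^ degree p = 1 - t * c" by blast
    have "inverse t = u ^ degree p * inverse t + c" using c(2) t(2) by (simp add: field_simps)
    then show False using s subring_add[OF A 1 c(1)] by simp
  qed
  then show "1 - t * b \<noteq> 0" "inverse (1 - t * b) \<in> A" using u0 by (auto simp: u_def)
qed

text \<open>
  The constant coefficient \<open>b\<close> of \<open>q\<close> can be moved to the left of \<open>1 = t * poly q (1 / x)\<close> and
  absorbed by the unit \<open>1 - t * b\<close>. Multiplied by \<open>x ^ n\<close>, where \<open>n\<close> is the degree of \<open>p\<close>, this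
  writes \<open>x ^ n\<close> as a polynomial in \<open>x\<close> of lower degree, which then replaces the leading monomial
  of \<open>p\<close>.
\<close>

lemma maximal_avoiding_lower_degree:
  assumes max: "maximal_avoiding (inverse t) A" and t: "t \<in> A" "t \<noteq> 0" and x: "x \<noteq> 0"
    and p: "p \<in> polys_over A" "poly p x = inverse t"
    and q: "q \<in> polys_over A" "poly q (inverse x) = inverse t"
    and le: "degree q \<le> degree p"
  shows "\<exists>p'\<in>polys_over A. poly p' x = inverse t \<and> degree p' < degree p"
proof -
  have A: "is_subring A" and s: "inverse t \<notin> A" using max by (auto simp: maximal_avoiding_def)
  define n where "n = degree p"
  have n: "0 < n"
  proof (rule ccontr)
    assume "\<not> 0 < n"
    then obtain a where "p = [:a:]" using degree_eq_zeroE by (auto simp: n_def)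
    then have "poly p x = coeff p 0" by simp
    then show False using p s by (auto simp: polys_over_def)
  qed
  obtain b q' where q': "q = pCons b q'" by (cases q)
  have b: "b \<in> A" and q'A: "q' \<in> polys_over A"
    using q(1) unfolding q' polys_over_def by (auto simp: coeff_pCons split: nat.splits)
  define v where "v = inverse (1 - t * b)"
  have v: "v \<in> A" "1 - t * b \<noteq> 0"
    using maximal_avoiding_inverse_one_minus[OF max t b] by (auto simp: v_def)
  have dq': "degree q' \<le> n - 1"
    using le unfolding q' n_def by (cases "q' = 0") auto
  \<comment> \<open>the value at \<open>x\<close> is \<open>v * t * x ^ (n - 1) * poly q' (1 / x)\<close>; reversing the coefficients of
    \<open>q'\<close> clears the negative powers of \<open>x\<close>\<close>
  define r where "r = smult (v * t) (monom 1 (n - 1 - degree q') * reflect_poly q')"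
  have rA: "r \<in> polys_over A"
    unfolding r_def using A v t q'A
    by (intro polys_over_smult polys_over_mult polys_over_monom polys_over_reflect subring_mult
        subring_one)
  have "degree r \<le> degree (monom (1::'a) (n - 1 - degree q')) + degree (reflect_poly q')"
    unfolding r_def by (meson degree_smult_le degree_mult_le order_trans)
  also have "\<dots> \<le> n - 1"
    using dq' degree_reflect_poly_le[of q'] by (simp add: degree_monom_eq)
  finally have dr: "degree r < n" using n by linarith
  have xr: "poly r x = x ^ n"
  proof -
    have "1 - t * b = t * inverse x * poly q' (inverse x)"
      using q(2) t(2) by (simp add: q' field_simps)
    then have "v * t * (inverse x * poly q' (inverse x)) = v * (1 - t * b)"
      by (simp only: mult.assoc)
    also have "\<dots> = 1" using v(2) unfolding v_def by (rule left_inverse)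
    finally have unit: "v * t * (inverse x * poly q' (inverse x)) = 1" .
    have "poly r x = v * t * (x ^ (n - 1 - degree q' + degree q') * poly q' (inverse x))"
      using x by (simp add: r_def poly_monom poly_reflect_poly_nz power_add mult_ac)
    moreover have "x ^ (n - 1 - degree q' + degree q') = x ^ n * inverse x"
      using dq' n x by (cases n) auto
    ultimately have "poly r x = x ^ n * (v * t * (inverse x * poly q' (inverse x)))"
      by (simp only: mult_ac)
    then show ?thesis by (simp only: unit mult_1_right)
  qed
  define p' where "p' = p - monom (lead_coeff p) n + smult (lead_coeff p) r"
  have lc: "lead_coeff p \<in> A" using p(1) by (simp add: polys_over_def)
  have "p' \<in> polys_over A"
    unfolding p'_def using A p(1) rA lc
    by (intro polys_over_add polys_over_diff polys_over_monom polys_over_smult)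
  moreover have "poly p' x = inverse t" by (simp add: p'_def p(2) xr poly_monom)
  moreover have "degree p' < n"
  proof -
    have "coeff p' i = 0" if "i \<ge> n" for i
    proof (cases "i = n")
      case True
      then show ?thesis using dr by (simp add: p'_def coeff_eq_0 n_def)
    next
      case False
      then show ?thesis using that dr by (simp add: p'_def coeff_eq_0 n_def)
    qed
    then have "degree p' \<le> n - 1" using n by (intro degree_le) auto
    then show ?thesis using n by linarith
  qed
  ultimately show ?thesis unfolding n_def by blast
qed

theorem maximal_avoiding_is_valuation_ring:
  assumes max: "maximal_avoiding (inverse t) A" and t: "t \<in> A" "t \<noteq> 0" and x: "x \<noteq> 0"
  shows "x \<in> A \<or> inverse x \<in> A"
proof (rule ccontr)
  assume "\<not> (x \<in> A \<or> inverse x \<in> A)"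
  then have *: "inverse t \<in> adjoin A x" "inverse t \<in> adjoin A (inverse x)"
    using maximal_avoiding_adjoin[OF max] by auto
  have least: "\<exists>p\<in>polys_over A. poly p y = inverse t \<and>
      (\<forall>q\<in>polys_over A. poly q y = inverse t \<longrightarrow> degree p \<le> degree q)"
    if y: "inverse t \<in> adjoin A y" for y
  proof -
    obtain p where "p \<in> polys_over A \<and> poly p y = inverse t" using y by (auto simp: adjoin_def)
    from ex_has_least_nat[where P = "\<lambda>p. p \<in> polys_over A \<and> poly p y = inverse t" and m = degree,
        OF this]
    show ?thesis by blast
  qed
  obtain p where p: "p \<in> polys_over A" "poly p x = inverse t"
      "\<And>q. q \<in> polys_over A \<Longrightarrow> poly q x = inverse t \<Longrightarrow> degree p \<le> degree q"
    using least[OF *(1)] by blast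
  obtain q where q: "q \<in> polys_over A" "poly q (inverse x) = inverse t"
      "\<And>p. p \<in> polys_over A \<Longrightarrow> poly p (inverse x) = inverse t \<Longrightarrow> degree q \<le> degree p"
    using least[OF *(2)] by blast
  show False
  proof (cases "degree q \<le> degree p")
    case True
    then show False
      using maximal_avoiding_lower_degree[OF max t x p(1,2) q(1,2)] p(3) by (meson not_le)
  next
    case False
    then show False
      using maximal_avoiding_lower_degree[OF max t _ q(1,2), of p] x p(1,2) q(3)
      by (metis inverse_inverse_eq nonzero_imp_inverse_nonzero nle_le not_le)
  qed
qed

section \<open>Transcendental real numbers\<close>

lemma countable_algebraic_reals: "countable {x::real. algebraic x}"
proof -
  have "countable (polys_over (\<rat> :: real set))"
  proof (rule countable_image_inj_on)
    have "coeffs ` polys_over (\<rat> :: real set) \<subseteq> lists \<rat>"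
      by (auto simp: polys_over_def coeffs_def)
    then show "countable (coeffs ` polys_over (\<rat> :: real set))"
      using countable_lists[OF countable_rat] countable_subset by blast
  qed (simp add: inj_on_def coeffs_eq_iff)
  then have "countable (\<Union>p\<in>polys_over \<rat> - {0}. {x::real. poly p x = 0})"
    by (intro countable_UN) (auto intro: countable_finite poly_roots_finite)
  moreover have "{x::real. algebraic x} \<subseteq> (\<Union>p\<in>polys_over \<rat> - {0}. {x. poly p x = 0})"
    by (auto simp: algebraic_altdef polys_over_def)
  ultimately show ?thesis by (rule countable_subset[rotated])
qed

lemma exists_transcendental_real: "\<exists>t::real. \<not> algebraic t"
proof (rule ccontr)
  assume "\<nexists>t::real. \<not> algebraic t"
  then have "{x::real. algebraic x} = UNIV" by auto
  then show False using countable_algebraic_reals uncountable_UNIV_real by simp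
qed

lemma inverse_transcendental_notin_adjoin:
  assumes t: "\<not> algebraic (t :: 'a::field_char_0)"
  shows "inverse t \<notin> adjoin \<rat> t"
proof
  assume "inverse t \<in> adjoin \<rat> t"
  then obtain p where p: "p \<in> polys_over \<rat>" "poly p t = inverse t" by (auto simp: adjoin_def)
  have "t \<noteq> 0" using t by auto
  then have "poly (pCons (-1) p) t = 0" using p(2) by simp
  moreover have "\<And>i. coeff (pCons (-1) p) i \<in> \<rat>"
    using p(1) by (auto simp: polys_over_def coeff_pCons split: nat.splits)
  ultimately have "algebraic t" by (intro algebraicI'[of "pCons (-1) p"]) auto
  then show False using t by contradiction
qed

section \<open>The additive function\<close>

lemma (in vector_space_pair) linear_functional_vanishing_on_subspace:
  assumes V: "vs1.subspace V" and v: "v \<notin> V"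
  shows "\<exists>g. Vector_Spaces.linear s1 s2 g \<and> (\<forall>x\<in>V. g x = 0) \<and> g v = w"
proof -
  obtain B where B: "B \<subseteq> V" "vs1.independent B" "V \<subseteq> vs1.span B"
    using vs1.maximal_independent_subset by blast
  have span: "vs1.span B = V" using B V vs1.span_minimal by blast
  have vB: "v \<notin> B" using B(1) v by blast
  have "vs1.independent (insert v B)" using B(2) v span vB by (simp add: vs1.independent_insert)
  then obtain g where g: "Vector_Spaces.linear s1 s2 g"
      "\<forall>x\<in>insert v B. g x = (if x = v then w else 0)"
    using linear_independent_extend[of "insert v B" "\<lambda>x. if x = v then w else 0"] by blast
  have "g x = 0" if "x \<in> V" for x
  proof (rule linear_eq_0_on_span[OF g(1)])
    show "x \<in> vs1.span B" using that span by simp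
    show "\<And>b. b \<in> B \<Longrightarrow> g b = 0" using g(2) vB by auto
  qed
  then show ?thesis using g by auto
qed

theorem theorem24:
  shows "\<exists>f :: real \<Rightarrow> real. Modules.additive f \<and> (\<exists>x. f x \<noteq> 0)
    \<and> (\<forall>x. x \<noteq> 0 \<longrightarrow> f x * f (1 / x) = 0)"
proof -
  obtain t :: real where t: "\<not> algebraic t" using exists_transcendental_real by blast
  then have t0: "t \<noteq> 0" by auto
  obtain A where sub: "adjoin \<rat> t \<subseteq> A" and max: "maximal_avoiding (inverse t) A"
    using exists_maximal_avoiding[OF is_subring_adjoin[OF is_subring_Rats]
        inverse_transcendental_notin_adjoin[OF t]] by blast
  have A: "is_subring A" and s: "inverse t \<notin> A" using max by (auto simp: maximal_avoiding_def)
  have tA: "t \<in> A" and QA: "\<rat> \<subseteq> A"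
    using sub in_adjoin[OF is_subring_Rats, of t] subset_adjoin[OF is_subring_Rats, of t] by auto
  interpret Q: vector_space_pair "\<lambda>q x. real_of_rat q * x" "\<lambda>q x. real_of_rat q * x"
    by unfold_locales (auto simp: algebra_simps of_rat_add of_rat_mult)
  have "Q.vs1.subspace A"
    unfolding Q.vs1.subspace_def using A QA
    by (auto intro!: subring_zero subring_add subring_mult)
  then obtain f where f: "Vector_Spaces.linear (\<lambda>q x. real_of_rat q * x) (\<lambda>q x. real_of_rat q * x) f"
      "\<forall>x\<in>A. f x = 0" "f (inverse t) = 1"
    using Q.linear_functional_vanishing_on_subspace s by blast
  have "Modules.additive f"
    by (rule Modules.additive.intro) (rule Q.linear_add[OF f(1)])
  moreover have "f x * f (1 / x) = 0" if "x \<noteq> 0" for x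
    using maximal_avoiding_is_valuation_ring[OF max tA t0 that] f(2) by (auto simp: divide_inverse)
  ultimately show ?thesis using f(3) by (metis zero_neq_one)
qed

end
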